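(* Let $(X,\mathcal A)$ be an analytic measurable space, $\Sigma$ a countable set of actions, $c\in[0,1]$, $\gamma$ a Markov decision process on $X$, and $\mathcal L$ a language as in the context. If every function $f_{iy}\colon[0,1]^{n_i}\to[0,1]$ interpreting a function symbol is nonexpansive with respect to the supremum distance $d_\infty(\vec u,\vec v)=\max_{1\le j\le n_i}|u_j-v_j|$, then $\mathcal L$ is adequate, i.e. $d_{\mathcal L}\le d_B$ pointwise on $X\times X$. Moreover, the language whose function symbols are exactly the families scalar addition $\cdot+r$, scalar subtraction $\cdot-r$, scalar multiplication $r\cdot$ ($r\in[0,1]$) and convex combination $\cdot+_\lambda\cdot$ ($\lambda\in[0,1]$), interpreted respectively as $x\mapsto\min\{1,x+r\}$, $x\mapsto\max\{0,x-r\}$, $x\mapsto rx$, $(x,y)\mapsto\lambda x+(1-\lambda)y$ (together with $\top,\neg,\wedge,\diamond_a$), is adequate.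
   Context: A subset of $(X,\mathcal A)$ is Suslin if it is the projection to $X$ of a set in $\mathcal B(\mathbb N^{\mathbb N})\otimes\mathcal A$; $(X,\mathcal A)$ is analytic if isomorphic to a Suslin subset of a standard Borel space with the restricted $\sigma$-algebra. A Markov decision process assigns to each $a\in\Sigma,x\in X$ a probability measure $\gamma^0_{a,x}$ on $X$ and a reward $\gamma^1_{a,x}\in[0,1]$, with $x\mapsto\gamma^0_{a,x}(U)$ ($U\in\mathcal A$) and $x\mapsto\gamma^1_{a,x}$ measurable. Language: for each $i\in\omega$ a set $Y_i$ and arity $n_i\ge0$, and for each $y\in Y_i$ a function symbol $f_{iy}$ interpreted by a fixed $f_{iy}\colon[0,1]^{n_i}\to[0,1]$. Formulas: $\top\mid\neg\varphi\mid\varphi\wedge\psi\mid\diamond_a\varphi\ (a\in\Sigma)\mid f_{iy}(\varphi_1,\dots,\varphi_{n_i})$. Interpretation: $[\![\top]\!]=1$, $[\![\neg\varphi]\!]=1-[\![\varphi]\!]$, $[\![\varphi\wedge\psi]\!]=\min$, $[\![f_{iy}(\varphi_1,\ldots)]\!](x)=f_{iy}([\![\varphi_1]\!](x),\ldots)$, $[\![\diamond_a\varphi]\!](x)=c\int[\![\varphi]\!]\,d\gamma^0_{a,x}+(1-c)\gamma^1_{a,x}$. $d_{\mathcal L}(x,y)=\sup_{\varphi}|[\![\varphi]\!](x)-[\![\varphi]\!](y)|$. $K(\mu,\nu)$ is the set of couplings (probability measures on $X\times X$ with marginals $\mu,\nu$). $d_B$ is the least fixpoint (pointwise $\le$) of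 $\Phi(d)(x,y)=\sup_{a\in\Sigma}\big[c\inf_{\omega\in K(\gamma^0_{a,x},\gamma^0_{a,y})}\int d\,d\omega+(1-c)|\gamma^1_{a,x}-\gamma^1_{a,y}|\big]$ on universally measurable $d\colon X\times X\to[0,1]$. *)

theory Defs
  imports "HOL-Probability.Probability"
begin

section \<open>Analytic measurable spaces\<close>

definition standard_borel :: "'a measure \<Rightarrow> bool" where
  "standard_borel M \<longleftrightarrow>
     (\<exists>T. completely_metrizable_space T \<and> separable_space T \<and> topspace T = space M \<and>
          sets M = sigma_sets (topspace T) {U. openin T U})"

definition suslin_subset :: "'a measure \<Rightarrow> 'a set \<Rightarrow> bool" where
  "suslin_subset M S \<longleftrightarrow>
     (\<exists>B \<in> sets ((borel :: (nat \<Rightarrow> nat) measure) \<Otimes>\<^sub>M M). S = snd ` B)"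

definition measurably_isomorphic :: "'a measure \<Rightarrow> 'b measure \<Rightarrow> bool" where
  "measurably_isomorphic M N \<longleftrightarrow>
     (\<exists>f \<in> M \<rightarrow>\<^sub>M N. \<exists>g \<in> N \<rightarrow>\<^sub>M M. (\<forall>x \<in> space M. g (f x) = x) \<and> (\<forall>y \<in> space N. f (g y) = y))"

text \<open>The ambient standard Borel space may live on any type \<^typ>\<open>'z\<close>; HOL cannot quantify over
  types inside a formula, so the type is an argument. As a hypothesis of a theorem that is polymorphic
  in \<^typ>\<open>'z\<close>, this is the existence of an ambient space on some type.\<close>

definition analytic_measurable_space :: "'z itself \<Rightarrow> 'a measure \<Rightarrow> bool" where
  "analytic_measurable_space _ M \<longleftrightarrow>
     (\<exists>(Z :: 'z measure) S. standard_borel Z \<and> S \<subseteq> space Z \<and> suslin_subset Z S \<and>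
        measurably_isomorphic M (restrict_space Z S))"


section \<open>Markov decision processes\<close>

text \<open>\<^term>\<open>\<gamma>\<^sub>0 a \<in> M \<rightarrow>\<^sub>M prob_algebra M\<close> says that each \<^term>\<open>\<gamma>\<^sub>0 a x\<close>
  is a probability measure on \<^term>\<open>M\<close>, measurable in \<^term>\<open>x\<close> on every measurable set.\<close>

definition markov_decision_process ::
  "'a measure \<Rightarrow> 's set \<Rightarrow> ('s \<Rightarrow> 'a \<Rightarrow> 'a measure) \<Rightarrow> ('s \<Rightarrow> 'a \<Rightarrow> real) \<Rightarrow> bool" where
  "markov_decision_process M Act \<gamma>\<^sub>0 \<gamma>\<^sub>1 \<longleftrightarrow>
     (\<forall>a \<in> Act. \<gamma>\<^sub>0 a \<in> M \<rightarrow>\<^sub>M prob_algebra M \<and>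
        \<gamma>\<^sub>1 a \<in> borel_measurable M \<and> (\<forall>x \<in> space M. \<gamma>\<^sub>1 a x \<in> {0..1}))"


section \<open>Languages and the logical distance\<close>

text \<open>The symbol \<open>f_iy\<close> is the pair of \<^term>\<open>i\<close> and \<open>y \<in> params L i\<close>; a point of
  \<open>[0,1]^n\<close> is a list of length \<open>n\<close>.\<close>

record 'y language =
  params :: "nat \<Rightarrow> 'y set"
  arity :: "nat \<Rightarrow> nat"
  interp :: "nat \<Rightarrow> 'y \<Rightarrow> real list \<Rightarrow> real"

definition cube :: "nat \<Rightarrow> real list set" where
  "cube n = {us. length us = n \<and> set us \<subseteq> {0..1}}"

definition is_language :: "'y language \<Rightarrow> bool" where
  "is_language L \<longleftrightarrow>
     (\<forall>i. \<forall>y \<in> params L i. \<forall>us \<in> cube (arity L i). interp L i y us \<in> {0..1})"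

text \<open>The \<open>0\<close> matters only for arity \<open>0\<close>, where the maximum over no indices is \<open>0\<close>.\<close>

definition sup_dist :: "real list \<Rightarrow> real list \<Rightarrow> real" where
  "sup_dist us vs = Max (insert 0 {\<bar>us ! j - vs ! j\<bar> | j. j < length us})"

definition nonexpansive :: "nat \<Rightarrow> (real list \<Rightarrow> real) \<Rightarrow> bool" where
  "nonexpansive n f \<longleftrightarrow> (\<forall>us \<in> cube n. \<forall>vs \<in> cube n. \<bar>f us - f vs\<bar> \<le> sup_dist us vs)"

datatype ('s, 'y) fm =
    Top
  | Neg "('s, 'y) fm"
  | And "('s, 'y) fm" "('s, 'y) fm"
  | Dia 's "('s, 'y) fm"
  | App nat 'y "('s, 'y) fm list"

inductive_set formulas :: "'s set \<Rightarrow> 'y language \<Rightarrow> ('s, 'y) fm set"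
  for Act :: "'s set" and L :: "'y language" where
  Top: "Top \<in> formulas Act L"
| Neg: "\<phi> \<in> formulas Act L \<Longrightarrow> Neg \<phi> \<in> formulas Act L"
| And: "\<phi> \<in> formulas Act L \<Longrightarrow> \<psi> \<in> formulas Act L \<Longrightarrow> And \<phi> \<psi> \<in> formulas Act L"
| Dia: "a \<in> Act \<Longrightarrow> \<phi> \<in> formulas Act L \<Longrightarrow> Dia a \<phi> \<in> formulas Act L"
| App: "y \<in> params L i \<Longrightarrow> length \<phi>s = arity L i \<Longrightarrow> (\<And>\<phi>. \<phi> \<in> set \<phi>s \<Longrightarrow> \<phi> \<in> formulas Act L)
    \<Longrightarrow> App i y \<phi>s \<in> formulas Act L"

fun sem :: "real \<Rightarrow> ('s \<Rightarrow> 'a \<Rightarrow> 'a measure) \<Rightarrow> ('s \<Rightarrow> 'a \<Rightarrow> real) \<Rightarrow> 'y language \<Rightarrow>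
    ('s, 'y) fm \<Rightarrow> 'a \<Rightarrow> real" where
  "sem c \<gamma>\<^sub>0 \<gamma>\<^sub>1 L Top x = 1"
| "sem c \<gamma>\<^sub>0 \<gamma>\<^sub>1 L (Neg \<phi>) x = 1 - sem c \<gamma>\<^sub>0 \<gamma>\<^sub>1 L \<phi> x"
| "sem c \<gamma>\<^sub>0 \<gamma>\<^sub>1 L (And \<phi> \<psi>) x = min (sem c \<gamma>\<^sub>0 \<gamma>\<^sub>1 L \<phi> x) (sem c \<gamma>\<^sub>0 \<gamma>\<^sub>1 L \<psi> x)"
| "sem c \<gamma>\<^sub>0 \<gamma>\<^sub>1 L (Dia a \<phi>) x =
     c * (\<integral>z. sem c \<gamma>\<^sub>0 \<gamma>\<^sub>1 L \<phi> z \<partial>(\<gamma>\<^sub>0 a x)) + (1 - c) * \<gamma>\<^sub>1 a x"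
| "sem c \<gamma>\<^sub>0 \<gamma>\<^sub>1 L (App i y \<phi>s) x = interp L i y (map (\<lambda>\<phi>. sem c \<gamma>\<^sub>0 \<gamma>\<^sub>1 L \<phi> x) \<phi>s)"

definition logical_dist ::
  "'s set \<Rightarrow> real \<Rightarrow> ('s \<Rightarrow> 'a \<Rightarrow> 'a measure) \<Rightarrow> ('s \<Rightarrow> 'a \<Rightarrow> real) \<Rightarrow> 'y language \<Rightarrow> 'a \<times> 'a \<Rightarrow> real"
  where
  "logical_dist Act c \<gamma>\<^sub>0 \<gamma>\<^sub>1 L = (\<lambda>(x, y).
     SUP \<phi> \<in> formulas Act L. \<bar>sem c \<gamma>\<^sub>0 \<gamma>\<^sub>1 L \<phi> x - sem c \<gamma>\<^sub>0 \<gamma>\<^sub>1 L \<phi> y\<bar>)"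


section \<open>The behavioural distance\<close>

definition couplings :: "'a measure \<Rightarrow> 'a measure \<Rightarrow> ('a \<times> 'a) measure set" where
  "couplings \<mu> \<nu> = {\<omega>. prob_space \<omega> \<and> sets \<omega> = sets (\<mu> \<Otimes>\<^sub>M \<nu>) \<and>
     distr \<omega> \<mu> fst = \<mu> \<and> distr \<omega> \<nu> snd = \<nu>}"

definition universally_measurable :: "'a measure \<Rightarrow> ('a \<Rightarrow> real) \<Rightarrow> bool" where
  "universally_measurable M f \<longleftrightarrow>
     (\<forall>\<mu>. finite_measure \<mu> \<and> sets \<mu> = sets M \<longrightarrow> f \<in> borel_measurable (completion \<mu>))"

definition distance_functions :: "'a measure \<Rightarrow> ('a \<times> 'a \<Rightarrow> real) set" where
  "distance_functions M = {d. universally_measurable (M \<Otimes>\<^sub>M M) d \<and>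
     (\<forall>p \<in> space M \<times> space M. d p \<in> {0..1})}"

text \<open>Integrals of universally measurable functions are taken against the completed measure.
  Inserting \<open>0\<close> makes the supremum the one in \<open>[0,1]\<close> also when there are no actions; it has no
  effect otherwise.\<close>

definition behavioural_op ::
  "'s set \<Rightarrow> real \<Rightarrow> ('s \<Rightarrow> 'a \<Rightarrow> 'a measure) \<Rightarrow> ('s \<Rightarrow> 'a \<Rightarrow> real) \<Rightarrow>
     ('a \<times> 'a \<Rightarrow> real) \<Rightarrow> 'a \<times> 'a \<Rightarrow> real" where
  "behavioural_op Act c \<gamma>\<^sub>0 \<gamma>\<^sub>1 d = (\<lambda>(x, y).
     Sup (insert 0 ((\<lambda>a.
       c * (INF \<omega> \<in> couplings (\<gamma>\<^sub>0 a x) (\<gamma>\<^sub>0 a y). \<integral>p. d p \<partial>(completion \<omega>))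
         + (1 - c) * \<bar>\<gamma>\<^sub>1 a x - \<gamma>\<^sub>1 a y\<bar>) ` Act)))"

definition behavioural_fixpoints ::
  "'a measure \<Rightarrow> 's set \<Rightarrow> real \<Rightarrow> ('s \<Rightarrow> 'a \<Rightarrow> 'a measure) \<Rightarrow> ('s \<Rightarrow> 'a \<Rightarrow> real) \<Rightarrow>
     ('a \<times> 'a \<Rightarrow> real) set" where
  "behavioural_fixpoints M Act c \<gamma>\<^sub>0 \<gamma>\<^sub>1 =
     {d \<in> distance_functions M. \<forall>p \<in> space M \<times> space M. behavioural_op Act c \<gamma>\<^sub>0 \<gamma>\<^sub>1 d p = d p}"

definition is_behavioural_dist ::
  "'a measure \<Rightarrow> 's set \<Rightarrow> real \<Rightarrow> ('s \<Rightarrow> 'a \<Rightarrow> 'a measure) \<Rightarrow> ('s \<Rightarrow> 'a \<Rightarrow> real) \<Rightarrow>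
     ('a \<times> 'a \<Rightarrow> real) \<Rightarrow> bool" where
  "is_behavioural_dist M Act c \<gamma>\<^sub>0 \<gamma>\<^sub>1 d \<longleftrightarrow>
     d \<in> behavioural_fixpoints M Act c \<gamma>\<^sub>0 \<gamma>\<^sub>1 \<and>
     (\<forall>d' \<in> behavioural_fixpoints M Act c \<gamma>\<^sub>0 \<gamma>\<^sub>1. \<forall>p \<in> space M \<times> space M. d p \<le> d' p)"

lemma is_behavioural_dist_unique:
  assumes "is_behavioural_dist M Act c \<gamma>\<^sub>0 \<gamma>\<^sub>1 d" "is_behavioural_dist M Act c \<gamma>\<^sub>0 \<gamma>\<^sub>1 d'"
    and "p \<in> space M \<times> space M"
  shows "d p = d' p"
  using assms unfolding is_behavioural_dist_def by (meson order_antisym)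

definition adequate ::
  "'a measure \<Rightarrow> 's set \<Rightarrow> real \<Rightarrow> ('s \<Rightarrow> 'a \<Rightarrow> 'a measure) \<Rightarrow> ('s \<Rightarrow> 'a \<Rightarrow> real) \<Rightarrow>
     ('a \<times> 'a \<Rightarrow> real) \<Rightarrow> 'y language \<Rightarrow> bool" where
  "adequate M Act c \<gamma>\<^sub>0 \<gamma>\<^sub>1 d\<^sub>B L \<longleftrightarrow>
     (\<forall>p \<in> space M \<times> space M. logical_dist Act c \<gamma>\<^sub>0 \<gamma>\<^sub>1 L p \<le> d\<^sub>B p)"


section \<open>The scalar language\<close>

text \<open>Families \<open>0\<close> to \<open>3\<close>: scalar addition, scalar subtraction, scalar multiplication, convex
  combination. All other families have no symbols.\<close>

definition scalar_language :: "real language" where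
  "scalar_language =
    \<lparr> params = (\<lambda>i. if i < 4 then {0..1} else {}),
      arity = (\<lambda>i. if i = 3 then 2 else 1),
      interp = (\<lambda>i r us.
        if i = 0 then min 1 (us ! 0 + r)
        else if i = 1 then max 0 (us ! 0 - r)
        else if i = 2 then r * us ! 0
        else r * us ! 0 + (1 - r) * us ! 1) \<rparr>"

end

theory Submission
  imports Defs
begin

text \<open>By structural induction every formula denotes a measurable function \<open>h\<close> into \<open>[0,1]\<close> with
  \<open>\<bar>h x - h y\<bar> \<le> d\<^sub>B (x, y)\<close>. For a modality, any coupling \<open>\<omega>\<close> of the two transition
  probabilities gives \<open>\<bar>\<integral>h d\<mu> - \<integral>h d\<nu>\<bar> \<le> \<integral>\<bar>h u - h v\<bar> d\<omega>(u, v) \<le> \<integral>d\<^sub>B d\<omega>\<close>, and one passes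
  to the infimum over \<open>\<omega>\<close> and uses that \<open>d\<^sub>B\<close> is a fixpoint. Only measurability of the function
  symbols needs a further idea: a nonexpansive map is continuous on the cube.\<close>

section \<open>Nonexpansive maps on the cube\<close>

lemma sup_dist_le:
  assumes "0 \<le> b" "\<And>j. j < length us \<Longrightarrow> \<bar>us ! j - vs ! j\<bar> \<le> b"
  shows "sup_dist us vs \<le> b"
proof -
  have "finite {\<bar>us ! j - vs ! j\<bar> | j. j < length us}"
    by simp
  then show ?thesis
    unfolding sup_dist_def using assms by (subst Max_le_iff) auto
qed

text \<open>Any common bound \<open>b\<close> on the coordinate differences may replace
  \<open>sup_dist\<close>. Below, \<open>b\<close> is first a sum of differences, to obtain
  continuity, and later the value of the behavioural distance at a pair of states.\<close>

lemma nonexpansiveD: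
  assumes "nonexpansive n f" "us \<in> cube n" "vs \<in> cube n" "0 \<le> b"
    and "\<And>j. j < n \<Longrightarrow> \<bar>us ! j - vs ! j\<bar> \<le> b"
  shows "\<bar>f us - f vs\<bar> \<le> b"
proof -
  have "length us = n"
    using assms(2) by (simp add: cube_def)
  then have "sup_dist us vs \<le> b"
    using assms by (intro sup_dist_le) auto
  moreover have "\<bar>f us - f vs\<bar> \<le> sup_dist us vs"
    using assms by (auto simp: nonexpansive_def)
  ultimately show ?thesis by linarith
qed

text \<open>Tuples are encoded as sequences \<open>nat \<Rightarrow> real\<close>, whose product
  topology makes Borel measurability a coordinatewise matter. Since \<open>f\<close> is controlled
  on the cube only, it is precomposed with a retraction onto the cube; the result is continuous
  everywhere, hence Borel.\<close>

lemma borel_measurable_nonexpansive: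
  fixes hs :: "('a \<Rightarrow> real) list"
  assumes f: "nonexpansive (length hs) f"
    and meas: "\<And>h. h \<in> set hs \<Longrightarrow> h \<in> borel_measurable M"
    and range: "\<And>h x. h \<in> set hs \<Longrightarrow> x \<in> space M \<Longrightarrow> h x \<in> {0..1}"
  shows "(\<lambda>x. f (map (\<lambda>h. h x) hs)) \<in> borel_measurable M"
proof -
  define n where "n = length hs"
  \<comment> \<open>\<open>clamp\<close> reads the first \<open>n\<close> terms of a sequence and
    truncates each to the unit interval, so terms already in that interval are unchanged.\<close>
  define clamp :: "(nat \<Rightarrow> real) \<Rightarrow> real list"
    where "clamp u = map (\<lambda>j. max 0 (min 1 (u j))) [0..<n]" for u
  have clamp_cube: "clamp u \<in> cube n" for u
    by (auto simp: clamp_def cube_def)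
  \<comment> \<open>The sum dominates the maximum and is visibly continuous in \<open>v\<close>,
    vanishing at \<open>v = u\<close>; a squeeze then gives the limit of \<open>f (clamp v)\<close>
    at \<open>u\<close>.\<close>
  have lip: "\<bar>f (clamp v) - f (clamp u)\<bar> \<le> (\<Sum>j<n. \<bar>v j - u j\<bar>)" for u v
  proof (rule nonexpansiveD[OF f[folded n_def] clamp_cube clamp_cube])
    fix j assume "j < n"
    then have "\<bar>clamp v ! j - clamp u ! j\<bar> \<le> \<bar>v j - u j\<bar>"
      by (auto simp: clamp_def)
    also have "\<dots> \<le> (\<Sum>j<n. \<bar>v j - u j\<bar>)"
      using \<open>j < n\<close> by (intro member_le_sum) auto
    finally show "\<bar>clamp v ! j - clamp u ! j\<bar> \<le> (\<Sum>j<n. \<bar>v j - u j\<bar>)" .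
  qed (simp add: sum_nonneg)
  have "continuous_on UNIV (\<lambda>u. f (clamp u))"
    unfolding continuous_on_def
  proof
    fix u :: "nat \<Rightarrow> real"
    have "continuous_on UNIV (\<lambda>v::nat \<Rightarrow> real. \<Sum>j<n. \<bar>v j - u j\<bar>)"
      by (intro continuous_intros continuous_on_product_coordinates)
    then have "((\<lambda>v. \<Sum>j<n. \<bar>v j - u j\<bar>) \<longlongrightarrow> (\<Sum>j<n. \<bar>u j - u j\<bar>)) (at u)"
      by (simp only: continuous_on_def) blast
    then have "((\<lambda>v. \<Sum>j<n. \<bar>v j - u j\<bar>) \<longlongrightarrow> 0) (at u)"
      by simp
    then have "((\<lambda>v. f (clamp v) - f (clamp u)) \<longlongrightarrow> 0) (at u)"
      by (rule Lim_null_comparison[rotated]) (simp add: lip)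
    then show "((\<lambda>u. f (clamp u)) \<longlongrightarrow> f (clamp u)) (at u within UNIV)"
      by (rule LIM_zero_cancel)
  qed
  then have cont: "(\<lambda>u. f (clamp u)) \<in> borel_measurable borel"
    by (rule borel_measurable_continuous_onI)
  \<comment> \<open>Padding by 0 from index \<open>n\<close> on makes every coordinate measurable;
    \<open>clamp\<close> never reads the padding.\<close>
  have "(\<lambda>x j. if j < n then (hs ! j) x else 0) \<in> borel_measurable M"
  proof (rule measurable_coordinatewise_then_product)
    fix j show "(\<lambda>x. if j < n then (hs ! j) x else 0) \<in> borel_measurable M"
      by (cases "j < n") (auto simp: n_def intro: meas)
  qed
  from measurable_compose[OF this cont]
  have "(\<lambda>x. f (clamp (\<lambda>j. if j < n then (hs ! j) x else 0))) \<in> borel_measurable M" .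
  moreover have "clamp (\<lambda>j. if j < n then (hs ! j) x else 0) = map (\<lambda>h. h x) hs"
    if "x \<in> space M" for x
    using range[OF nth_mem that] by (auto simp: clamp_def n_def intro!: nth_equalityI)
  ultimately show ?thesis
    by (simp cong: measurable_cong)
qed

section \<open>Couplings and integrals over completed measures\<close>

text \<open>This makes the set of couplings nonempty, without which the infimum over it would be an
  unspecified real.\<close>

lemma pair_measure_in_couplings:
  assumes "prob_space \<mu>" "prob_space \<nu>"
  shows "\<mu> \<Otimes>\<^sub>M \<nu> \<in> couplings \<mu> \<nu>"
proof -
  interpret \<mu>: prob_space \<mu> by fact
  interpret \<nu>: prob_space \<nu> by fact
  interpret pair_prob_space \<mu> \<nu> ..
  \<comment> \<open>The preimage of \<open>A\<close> under the second projection is the rectangle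
    \<open>space \<mu> \<times> A\<close>, whose measure is that of \<open>A\<close> because
    \<open>\<mu>\<close> has mass 1.\<close>
  have "distr (\<mu> \<Otimes>\<^sub>M \<nu>) \<nu> snd = \<nu>"
  proof (rule measure_eqI)
    fix A assume A: "A \<in> sets (distr (\<mu> \<Otimes>\<^sub>M \<nu>) \<nu> snd)"
    then have "snd -` A \<inter> space (\<mu> \<Otimes>\<^sub>M \<nu>) = space \<mu> \<times> A"
      using sets.sets_into_space[of A \<nu>] by (auto simp: space_pair_measure)
    with A show "emeasure (distr (\<mu> \<Otimes>\<^sub>M \<nu>) \<nu> snd) A = emeasure \<nu> A"
      by (simp add: emeasure_distr \<nu>.emeasure_pair_measure_Times \<mu>.emeasure_space_1)
  qed simp
  moreover have "prob_space (\<mu> \<Otimes>\<^sub>M \<nu>)"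
    by (rule prob_space_axioms)
  ultimately show ?thesis
    by (simp add: couplings_def \<nu>.distr_pair_fst)
qed

text \<open>Universal measurability applied to \<open>\<omega>\<close> itself gives measurability
  for its completion; a bounded measurable function on a probability space is integrable.\<close>

lemma integrable_universally_measurable:
  assumes "universally_measurable N d" "\<And>p. p \<in> space N \<Longrightarrow> d p \<in> {0..1}"
    and "prob_space \<omega>" "sets \<omega> = sets N"
  shows "integrable (completion \<omega>) d"
    and "integral\<^sup>L (completion \<omega>) d \<in> {0..1}"
proof -
  interpret prob_space \<omega> by fact
  interpret C: prob_space "completion \<omega>"
    by (rule prob_space_completion)
  have "d \<in> borel_measurable (completion \<omega>)"
    using assms finite_measure_axioms by (auto simp: universally_measurable_def)
  moreover have bd: "d p \<in> {0..1}" if "p \<in> space (completion \<omega>)" for p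
    using assms(2) sets_eq_imp_space_eq[OF assms(4)] that by simp
  ultimately show int: "integrable (completion \<omega>) d"
    by (intro C.integrable_const_bound[where B=1]) auto
  show "integral\<^sup>L (completion \<omega>) d \<in> {0..1}"
    using bd by (auto intro!: integral_nonneg_AE C.integral_le_const[OF int] AE_I2)
qed

text \<open>The easy half of Kantorovich-Rubinstein duality: the marginals turn both integrals of
  \<open>h\<close> into integrals over \<open>\<omega>\<close>, where the difference can be
  estimated pointwise by \<open>d\<close>.\<close>

lemma coupling_integral_bound:
  assumes \<mu>: "prob_space \<mu>" "sets \<mu> = sets M" and \<nu>: "prob_space \<nu>" "sets \<nu> = sets M"
    and h: "h \<in> borel_measurable M" "\<And>x. x \<in> space M \<Longrightarrow> h x \<in> {0..1::real}"
    and d: "d \<in> distance_functions M"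
    and hd: "\<And>x y. x \<in> space M \<Longrightarrow> y \<in> space M \<Longrightarrow> \<bar>h x - h y\<bar> \<le> d (x, y)"
    and \<omega>: "\<omega> \<in> couplings \<mu> \<nu>"
  shows "\<bar>(\<integral>x. h x \<partial>\<mu>) - (\<integral>x. h x \<partial>\<nu>)\<bar> \<le> (\<integral>p. d p \<partial>completion \<omega>)"
proof -
  interpret prob_space \<omega>
    using \<omega> by (simp add: couplings_def)
  have sets_\<omega>: "sets \<omega> = sets (M \<Otimes>\<^sub>M M)"
    using \<omega> sets_pair_measure_cong[OF \<mu>(2) \<nu>(2)] by (simp add: couplings_def)
  have space_\<omega>: "space \<omega> = space M \<times> space M"
    using sets_eq_imp_space_eq[OF sets_\<omega>] by (simp add: space_pair_measure)
  have fst: "fst \<in> \<omega> \<rightarrow>\<^sub>M M" and snd: "snd \<in> \<omega> \<rightarrow>\<^sub>M M"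
    by (simp_all cong: measurable_cong_sets add: measurable_cong_sets[OF sets_\<omega> refl])
  note h_fst = measurable_compose[OF fst h(1)] and h_snd = measurable_compose[OF snd h(1)]
  have int_fst: "integrable \<omega> (\<lambda>p. h (fst p))" and int_snd: "integrable \<omega> (\<lambda>p. h (snd p))"
    using h(2) by (auto intro!: integrable_const_bound[where B=1] AE_I2 h_fst h_snd simp: space_\<omega>)
  have "(\<integral>x. h x \<partial>\<mu>) = (\<integral>x. h x \<partial>distr \<omega> \<mu> fst)"
    using \<omega> by (simp add: couplings_def)
  also have "\<dots> = (\<integral>p. h (fst p) \<partial>\<omega>)"
    by (intro integral_distr) (use fst h(1) \<mu>(2) in \<open>simp_all cong: measurable_cong_sets\<close>)
  finally have \<mu>_eq: "(\<integral>x. h x \<partial>\<mu>) = (\<integral>p. h (fst p) \<partial>\<omega>)" .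
  have "(\<integral>x. h x \<partial>\<nu>) = (\<integral>x. h x \<partial>distr \<omega> \<nu> snd)"
    using \<omega> by (simp add: couplings_def)
  also have "\<dots> = (\<integral>p. h (snd p) \<partial>\<omega>)"
    by (intro integral_distr) (use snd h(1) \<nu>(2) in \<open>simp_all cong: measurable_cong_sets\<close>)
  finally have \<nu>_eq: "(\<integral>x. h x \<partial>\<nu>) = (\<integral>p. h (snd p) \<partial>\<omega>)" .
  have int_diff: "integrable \<omega> (\<lambda>p. \<bar>h (fst p) - h (snd p)\<bar>)"
    using int_fst int_snd by simp
  have int_d: "integrable (completion \<omega>) d"
    using d sets_\<omega> prob_space_axioms
    by (intro integrable_universally_measurable[of "M \<Otimes>\<^sub>M M"])
       (auto simp: distance_functions_def space_pair_measure)
  have "\<bar>(\<integral>x. h x \<partial>\<mu>) - (\<integral>x. h x \<partial>\<nu>)\<bar> = \<bar>\<integral>p. h (fst p) - h (snd p) \<partial>\<omega>\<bar>"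
    using int_fst int_snd by (simp add: \<mu>_eq \<nu>_eq)
  also have "\<dots> \<le> (\<integral>p. \<bar>h (fst p) - h (snd p)\<bar> \<partial>\<omega>)"
    by (rule integral_abs_bound)
  \<comment> \<open>The difference of the values of \<open>h\<close> is measurable for
    \<open>\<omega>\<close>, so completing the measure keeps its integral; \<open>d\<close> is known
    to be measurable only for the completion, so the comparison takes place there.\<close>
  also have "\<dots> = (\<integral>p. \<bar>h (fst p) - h (snd p)\<bar> \<partial>completion \<omega>)"
    using int_diff by (intro integral_completion[symmetric]) auto
  also have "\<dots> \<le> (\<integral>p. d p \<partial>completion \<omega>)"
    using int_diff int_d hd by (intro integral_mono) (auto simp: integrable_completion space_\<omega>)
  finally show ?thesis .
qed

section \<open>The behavioural operator and the induction on formulas\<close>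

text \<open>A real supremum dominates its terms once they are bounded above. Here 1 is a bound: each
  term is a convex combination of an infimum, at most the integral over the product coupling, and a
  difference of two rewards in the unit interval.\<close>

lemma behavioural_op_upper:
  assumes c: "c \<in> {0..1}" and mdp: "markov_decision_process M Act \<gamma>\<^sub>0 \<gamma>\<^sub>1"
    and d: "d \<in> distance_functions M"
    and x: "x \<in> space M" and y: "y \<in> space M" and a: "a \<in> Act"
  shows "c * (INF \<omega> \<in> couplings (\<gamma>\<^sub>0 a x) (\<gamma>\<^sub>0 a y). \<integral>p. d p \<partial>(completion \<omega>))
         + (1 - c) * \<bar>\<gamma>\<^sub>1 a x - \<gamma>\<^sub>1 a y\<bar> \<le> behavioural_op Act c \<gamma>\<^sub>0 \<gamma>\<^sub>1 d (x, y)"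
    (is "?t a \<le> _")
proof -
  have "?t b \<le> 1" if b: "b \<in> Act" for b
  proof -
    have prob: "prob_space (\<gamma>\<^sub>0 b z)" "sets (\<gamma>\<^sub>0 b z) = sets M" if "z \<in> space M" for z
      using measurable_space[of "\<gamma>\<^sub>0 b" M "prob_algebra M" z] mdp b that
      by (auto simp: markov_decision_process_def space_prob_algebra)
    let ?I = "\<lambda>\<omega>. \<integral>p. d p \<partial>(completion \<omega>)" and ?K = "couplings (\<gamma>\<^sub>0 b x) (\<gamma>\<^sub>0 b y)"
    have range: "?I \<omega> \<in> {0..1}" if "\<omega> \<in> ?K" for \<omega>
      using that d sets_pair_measure_cong[OF prob(2)[OF x] prob(2)[OF y]]
      by (intro integrable_universally_measurable[of "M \<Otimes>\<^sub>M M"])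
         (auto simp: distance_functions_def space_pair_measure couplings_def)
    have prod: "\<gamma>\<^sub>0 b x \<Otimes>\<^sub>M \<gamma>\<^sub>0 b y \<in> ?K"
      using prob x y by (intro pair_measure_in_couplings) auto
    have "(INF \<omega> \<in> ?K. ?I \<omega>) \<le> ?I (\<gamma>\<^sub>0 b x \<Otimes>\<^sub>M \<gamma>\<^sub>0 b y)"
      using range by (intro cINF_lower prod bdd_belowI2[where m=0]) auto
    with range[OF prod] have "(INF \<omega> \<in> ?K. ?I \<omega>) \<le> 1"
      by simp
    moreover have "\<gamma>\<^sub>1 b x \<in> {0..1}" "\<gamma>\<^sub>1 b y \<in> {0..1}"
      using mdp b x y by (auto simp: markov_decision_process_def)
    then have "\<bar>\<gamma>\<^sub>1 b x - \<gamma>\<^sub>1 b y\<bar> \<le> 1"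
      by auto
    ultimately show ?thesis
      using c by (intro convex_bound_le) auto
  qed
  then have "bdd_above (insert 0 (?t ` Act))"
    by (intro bdd_aboveI[where M=1]) auto
  then show ?thesis
    unfolding behavioural_op_def using a by (auto intro!: cSup_upper)
qed

text \<open>The distance bound alone is not inductive: modalities need measurability and boundedness
  to integrate the subformula, and function symbols need values in the unit interval to stay in the
  cube.\<close>

lemma sem_adequate:
  assumes c: "c \<in> {0..1}" and mdp: "markov_decision_process M Act \<gamma>\<^sub>0 \<gamma>\<^sub>1"
    and d: "d \<in> behavioural_fixpoints M Act c \<gamma>\<^sub>0 \<gamma>\<^sub>1"
    and L: "is_language L" "\<And>i y. y \<in> params L i \<Longrightarrow> nonexpansive (arity L i) (interp L i y)"
    and \<phi>: "\<phi> \<in> formulas Act L"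
  shows "sem c \<gamma>\<^sub>0 \<gamma>\<^sub>1 L \<phi> \<in> borel_measurable M \<and>
         (\<forall>x \<in> space M. sem c \<gamma>\<^sub>0 \<gamma>\<^sub>1 L \<phi> x \<in> {0..1}) \<and>
         (\<forall>x \<in> space M. \<forall>y \<in> space M.
            \<bar>sem c \<gamma>\<^sub>0 \<gamma>\<^sub>1 L \<phi> x - sem c \<gamma>\<^sub>0 \<gamma>\<^sub>1 L \<phi> y\<bar> \<le> d (x, y))"
  using \<phi>
proof (induction rule: formulas.induct)
  have d_dist: "d \<in> distance_functions M"
    using d by (simp add: behavioural_fixpoints_def)
  \<comment> \<open>Nonnegativity settles the constant formula \<open>Top\<close> and is the side
    condition \<open>0 \<le> b\<close> of \<open>nonexpansiveD\<close> for function symbols.\<close>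
  then have d_nonneg: "0 \<le> d (x, y)" if "x \<in> space M" "y \<in> space M" for x y
    using that by (force simp: distance_functions_def)
  {
    case Top
    have "sem c \<gamma>\<^sub>0 \<gamma>\<^sub>1 L Top = (\<lambda>_. 1)" by auto
    then show ?case using d_nonneg by simp
  next
    case (Neg \<phi>)
    have "sem c \<gamma>\<^sub>0 \<gamma>\<^sub>1 L (Neg \<phi>) = (\<lambda>x. 1 - sem c \<gamma>\<^sub>0 \<gamma>\<^sub>1 L \<phi> x)" by auto
    with Neg.IH show ?case
      by (auto simp: abs_minus_commute)
  next
    case (And \<phi> \<psi>)
    have "sem c \<gamma>\<^sub>0 \<gamma>\<^sub>1 L (And \<phi> \<psi>) = (\<lambda>x. min (sem c \<gamma>\<^sub>0 \<gamma>\<^sub>1 L \<phi> x) (sem c \<gamma>\<^sub>0 \<gamma>\<^sub>1 L \<psi> x))"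
      by auto
    moreover have "\<bar>min p q - min p' q'\<bar> \<le> b"
      if "\<bar>p - p'\<bar> \<le> b" "\<bar>q - q'\<bar> \<le> b" for p q p' q' b :: real
      using that by linarith
    ultimately show ?case
      using And.IH by (auto simp: min_le_iff_disj)
  next
    case (Dia a \<phi>)
    let ?h = "sem c \<gamma>\<^sub>0 \<gamma>\<^sub>1 L \<phi>"
    have h: "?h \<in> borel_measurable M" "\<And>x. x \<in> space M \<Longrightarrow> ?h x \<in> {0..1}"
      "\<And>x y. x \<in> space M \<Longrightarrow> y \<in> space M \<Longrightarrow> \<bar>?h x - ?h y\<bar> \<le> d (x, y)"
      using Dia.IH by auto
    have \<gamma>\<^sub>0: "\<gamma>\<^sub>0 a \<in> M \<rightarrow>\<^sub>M prob_algebra M" and \<gamma>\<^sub>1: "\<gamma>\<^sub>1 a \<in> borel_measurable M"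
      and reward: "\<And>x. x \<in> space M \<Longrightarrow> \<gamma>\<^sub>1 a x \<in> {0..1}"
      using mdp Dia.hyps by (auto simp: markov_decision_process_def)
    have prob: "prob_space (\<gamma>\<^sub>0 a x)" "sets (\<gamma>\<^sub>0 a x) = sets M" if "x \<in> space M" for x
      using measurable_space[OF \<gamma>\<^sub>0 that] by (auto simp: space_prob_algebra)
    let ?I = "\<lambda>x. \<integral>z. ?h z \<partial>\<gamma>\<^sub>0 a x"
    have sem: "sem c \<gamma>\<^sub>0 \<gamma>\<^sub>1 L (Dia a \<phi>) = (\<lambda>x. c * ?I x + (1 - c) * \<gamma>\<^sub>1 a x)"
      by auto
    \<comment> \<open>The kernel is a measurable map into the space of measures, on which
      integration of a fixed measurable function is measurable.\<close>
    have "?I \<in> borel_measurable M"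
      using measurable_compose[OF measurable_prob_algebraD[OF \<gamma>\<^sub>0]
          integral_measurable_subprob_algebra[OF h(1)]] .
    then have "(\<lambda>x. c * ?I x + (1 - c) * \<gamma>\<^sub>1 a x) \<in> borel_measurable M"
      using \<gamma>\<^sub>1 by measurable
    moreover have "c * ?I x + (1 - c) * \<gamma>\<^sub>1 a x \<in> {0..1}" if x: "x \<in> space M" for x
    proof -
      interpret prob_space "\<gamma>\<^sub>0 a x" using prob x by blast
      have space: "space (\<gamma>\<^sub>0 a x) = space M"
        using sets_eq_imp_space_eq[OF prob(2)[OF x]] .
      have "integrable (\<gamma>\<^sub>0 a x) ?h"
        using h prob(2)[OF x]
        by (intro integrable_const_bound[where B=1] AE_I2)
           (auto simp: space cong: measurable_cong_sets)
      then have "?I x \<le> 1" "0 \<le> ?I x"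
        using h(2) by (auto intro!: integral_le_const integral_nonneg_AE AE_I2 simp: space)
      with c reward[OF x] show ?thesis
        by (auto intro!: convex_bound_le)
    qed
    moreover have "\<bar>(c * ?I x + (1 - c) * \<gamma>\<^sub>1 a x) - (c * ?I y + (1 - c) * \<gamma>\<^sub>1 a y)\<bar> \<le> d (x, y)"
      if x: "x \<in> space M" and y: "y \<in> space M" for x y
    proof -
      let ?D = "INF \<omega> \<in> couplings (\<gamma>\<^sub>0 a x) (\<gamma>\<^sub>0 a y). \<integral>p. d p \<partial>(completion \<omega>)"
      have "couplings (\<gamma>\<^sub>0 a x) (\<gamma>\<^sub>0 a y) \<noteq> {}"
        using pair_measure_in_couplings prob x y by blast
      \<comment> \<open>The left side bounds the integral of \<open>d\<close> over every coupling
        from below, hence also the infimum, as couplings exist.\<close>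
      then have D: "\<bar>?I x - ?I y\<bar> \<le> ?D"
        using coupling_integral_bound[OF prob[OF x] prob[OF y] h(1,2) d_dist h(3)]
        by (intro cINF_greatest) auto
      have "\<bar>(c * ?I x + (1 - c) * \<gamma>\<^sub>1 a x) - (c * ?I y + (1 - c) * \<gamma>\<^sub>1 a y)\<bar>
          = \<bar>c * (?I x - ?I y) + (1 - c) * (\<gamma>\<^sub>1 a x - \<gamma>\<^sub>1 a y)\<bar>"
        by (simp add: algebra_simps)
      also have "\<dots> \<le> \<bar>c * (?I x - ?I y)\<bar> + \<bar>(1 - c) * (\<gamma>\<^sub>1 a x - \<gamma>\<^sub>1 a y)\<bar>"
        by (rule abs_triangle_ineq)
      also have "\<dots> = c * \<bar>?I x - ?I y\<bar> + (1 - c) * \<bar>\<gamma>\<^sub>1 a x - \<gamma>\<^sub>1 a y\<bar>"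
        using c by (simp add: abs_mult)
      also have "\<dots> \<le> c * ?D + (1 - c) * \<bar>\<gamma>\<^sub>1 a x - \<gamma>\<^sub>1 a y\<bar>"
        using c D by (intro add_right_mono mult_left_mono) auto
      also have "\<dots> \<le> behavioural_op Act c \<gamma>\<^sub>0 \<gamma>\<^sub>1 d (x, y)"
        using behavioural_op_upper[OF c mdp d_dist x y Dia.hyps(1)] .
      also have "\<dots> = d (x, y)"
        using d x y by (simp add: behavioural_fixpoints_def)
      finally show ?thesis .
    qed
    ultimately show ?case
      unfolding sem by blast
  next
    case (App y i \<phi>s)
    let ?hs = "map (sem c \<gamma>\<^sub>0 \<gamma>\<^sub>1 L) \<phi>s"
    \<comment> \<open>Evaluating a list of functions at \<open>x\<close>, rather than a list of
      formulas, matches the shape of \<open>borel_measurable_nonexpansive\<close>.\<close>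
    have sem: "sem c \<gamma>\<^sub>0 \<gamma>\<^sub>1 L (App i y \<phi>s) = (\<lambda>x. interp L i y (map (\<lambda>h. h x) ?hs))"
      by (auto simp: comp_def)
    have nonexp: "nonexpansive (arity L i) (interp L i y)"
      using L(2) App.hyps by blast
    have cube: "map (\<lambda>h. h x) ?hs \<in> cube (arity L i)" if "x \<in> space M" for x
      using App that by (auto simp: cube_def)
    have "(\<lambda>x. interp L i y (map (\<lambda>h. h x) ?hs)) \<in> borel_measurable M"
      using nonexp App by (intro borel_measurable_nonexpansive) auto
    moreover have "interp L i y (map (\<lambda>h. h x) ?hs) \<in> {0..1}" if "x \<in> space M" for x
      using L(1) App.hyps(1) cube[OF that] unfolding is_language_def by blast
    moreover have "\<bar>interp L i y (map (\<lambda>h. h x) ?hs) - interp L i y (map (\<lambda>h. h z) ?hs)\<bar> \<le> d (x, z)"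
      if "x \<in> space M" "z \<in> space M" for x z
      \<comment> \<open>The induction hypotheses bound every coordinate difference by the same
        number \<open>d (x, z)\<close>.\<close>
      using App that by (intro nonexpansiveD[OF nonexp cube cube d_nonneg]) auto
    ultimately show ?case
      unfolding sem by blast
  }
qed

lemma adequate_nonexpansive:
  assumes "c \<in> {0..1}" "markov_decision_process M Act \<gamma>\<^sub>0 \<gamma>\<^sub>1"
    and "d \<in> behavioural_fixpoints M Act c \<gamma>\<^sub>0 \<gamma>\<^sub>1"
    and "is_language L" "\<And>i y. y \<in> params L i \<Longrightarrow> nonexpansive (arity L i) (interp L i y)"
  shows "adequate M Act c \<gamma>\<^sub>0 \<gamma>\<^sub>1 d L"
proof -
  \<comment> \<open>A real supremum lies below every upper bound only over a nonempty index set;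
    \<open>Top\<close> provides a member for any language.\<close>
  have "formulas Act L \<noteq> {}"
    using formulas.Top by blast
  then show ?thesis
    using sem_adequate[OF assms] unfolding adequate_def logical_dist_def
    by (auto intro!: cSUP_least)
qed

section \<open>The scalar language\<close>

lemma is_language_scalar_language: "is_language scalar_language"
  unfolding is_language_def
proof (intro allI ballI)
  fix i r us
  assume r: "r \<in> params scalar_language i" and us: "us \<in> cube (arity scalar_language i)"
  have i: "i < 4" and r01: "0 \<le> r" "r \<le> 1"
    using r by (auto simp: scalar_language_def split: if_splits)
  have nth: "us ! j \<in> {0..1}" if "j < arity scalar_language i" for j
    using us that by (auto simp: cube_def dest!: subsetD[OF _ nth_mem])
  \<comment> \<open>Every family has arity 1 or 2, so index 0 is always in range; index 1 is
    available only in family 3.\<close>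
  then have nth0: "0 \<le> us ! 0" "us ! 0 \<le> 1"
    by (auto simp: scalar_language_def)
  consider "i = 0" | "i = 1" | "i = 2" | "i = 3"
    using i by linarith
  then show "interp scalar_language i r us \<in> {0..1}"
  proof cases
    case 3
    then show ?thesis
      using r01 nth0 by (simp add: scalar_language_def mult_le_one)
  next
    case 4
    then have "0 \<le> us ! 1" "us ! 1 \<le> 1"
      using nth[of 1] by (auto simp: scalar_language_def)
    with 4 r01 nth0 show ?thesis
      by (auto simp: scalar_language_def intro!: convex_bound_le)
  qed (use r01 nth0 in \<open>auto simp: scalar_language_def\<close>)
qed

text \<open>Shifting and then truncating at 0 or 1 does not increase distances, a scalar factor is
  at most 1, and the weights of a convex combination are nonnegative with sum 1.\<close>

lemma nonexpansive_scalar_language: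
  assumes r: "r \<in> params scalar_language i"
  shows "nonexpansive (arity scalar_language i) (interp scalar_language i r)"
  unfolding nonexpansive_def
proof (intro ballI)
  fix us vs
  assume us: "us \<in> cube (arity scalar_language i)" and vs: "vs \<in> cube (arity scalar_language i)"
  have i: "i < 4" and r01: "0 \<le> r" "r \<le> 1"
    using r by (auto simp: scalar_language_def split: if_splits)
  have nth: "\<bar>us ! j - vs ! j\<bar> \<le> sup_dist us vs" if "j < arity scalar_language i" for j
    using us that unfolding sup_dist_def cube_def by (intro Max_ge) auto
  then have nth0: "\<bar>us ! 0 - vs ! 0\<bar> \<le> sup_dist us vs"
    by (simp add: scalar_language_def)
  consider "i = 0" | "i = 1" | "i = 2" | "i = 3"
    using i by linarith
  then show "\<bar>interp scalar_language i r us - interp scalar_language i r vs\<bar> \<le> sup_dist us vs"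
  proof cases
    case 3
    have "\<bar>r * us ! 0 - r * vs ! 0\<bar> = r * \<bar>us ! 0 - vs ! 0\<bar>"
      using r01 by (simp add: abs_mult flip: right_diff_distrib)
    also have "\<dots> \<le> \<bar>us ! 0 - vs ! 0\<bar>"
      using r01 by (intro mult_left_le_one_le) auto
    finally show ?thesis
      using 3 nth0 by (simp add: scalar_language_def)
  next
    case 4
    have nth1: "\<bar>us ! 1 - vs ! 1\<bar> \<le> sup_dist us vs"
      using nth[of 1] 4 by (simp add: scalar_language_def)
    have "\<bar>(r * us ! 0 + (1 - r) * us ! 1) - (r * vs ! 0 + (1 - r) * vs ! 1)\<bar>
        = \<bar>r * (us ! 0 - vs ! 0) + (1 - r) * (us ! 1 - vs ! 1)\<bar>"
      by (simp add: algebra_simps)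
    also have "\<dots> \<le> \<bar>r * (us ! 0 - vs ! 0)\<bar> + \<bar>(1 - r) * (us ! 1 - vs ! 1)\<bar>"
      by (rule abs_triangle_ineq)
    also have "\<dots> = r * \<bar>us ! 0 - vs ! 0\<bar> + (1 - r) * \<bar>us ! 1 - vs ! 1\<bar>"
      using r01 by (simp add: abs_mult)
    also have "\<dots> \<le> sup_dist us vs"
      using r01 nth0 nth1 by (intro convex_bound_le) auto
    finally show ?thesis
      using 4 by (simp add: scalar_language_def)
  qed (use nth0 in \<open>auto simp: scalar_language_def\<close>)
qed

theorem theorem5p6:
  fixes M :: "'a measure" and Act :: "'s set" and c :: real
    and \<gamma>\<^sub>0 :: "'s \<Rightarrow> 'a \<Rightarrow> 'a measure" and \<gamma>\<^sub>1 :: "'s \<Rightarrow> 'a \<Rightarrow> real"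
    and d\<^sub>B :: "'a \<times> 'a \<Rightarrow> real"
    and L :: "'y language"
  assumes "analytic_measurable_space TYPE('z) M"
    and "countable Act"
    and "c \<in> {0..1}"
    and "markov_decision_process M Act \<gamma>\<^sub>0 \<gamma>\<^sub>1"
    and "is_behavioural_dist M Act c \<gamma>\<^sub>0 \<gamma>\<^sub>1 d\<^sub>B"
  shows "(is_language L \<and> (\<forall>i. \<forall>y \<in> params L i. nonexpansive (arity L i) (interp L i y))
            \<longrightarrow> adequate M Act c \<gamma>\<^sub>0 \<gamma>\<^sub>1 d\<^sub>B L)
       \<and> adequate M Act c \<gamma>\<^sub>0 \<gamma>\<^sub>1 d\<^sub>B scalar_language"
proof -
  have d\<^sub>B: "d\<^sub>B \<in> behavioural_fixpoints M Act c \<gamma>\<^sub>0 \<gamma>\<^sub>1"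
    using assms(5) by (simp add: is_behavioural_dist_def)
  have "adequate M Act c \<gamma>\<^sub>0 \<gamma>\<^sub>1 d\<^sub>B scalar_language"
    by (intro adequate_nonexpansive[OF assms(3,4) d\<^sub>B] is_language_scalar_language
        nonexpansive_scalar_language)
  moreover have "adequate M Act c \<gamma>\<^sub>0 \<gamma>\<^sub>1 d\<^sub>B L"
    if "is_language L" "\<forall>i. \<forall>y \<in> params L i. nonexpansive (arity L i) (interp L i y)"
    using that by (intro adequate_nonexpansive[OF assms(3,4) d\<^sub>B]) auto
  ultimately show ?thesis by blast
qed

end
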